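(* Let $\mathbb{K}$ be an algebraically closed field of characteristic zero, let $B$ be a commutative $\mathbb{K}$-domain, and let $D$ be a locally nilpotent derivation on $B$. Let $m,n_1,\dots,n_m$ be positive integers with $m\ge 3$, let $a_1,\dots,a_m\in \mathrm{Ker}\, D$ be nonzero, and for $1\le i\le m$, $1\le j\le n_i$ let $k_{ij}$ be positive integers and $b_{ij}\in B$. Put $$f_i:=a_i\, b_{i1}^{k_{i1}}\cdots b_{in_i}^{k_{in_i}}\in B,\qquad i=1,\dots,m.$$ Suppose that $f_1+\dots+f_m=0$, that the elements $f_1,\dots,f_m$ are pairwise relatively prime in $B$, and that $$\sum_{i=1}^{m}\sum_{j=1}^{n_i}\frac{1}{k_{ij}}\le \frac{1}{m-2}.$$ Then $b_{ij}\in \mathrm{Ker}\, D$ for all $i=1,\dots,m$ and $j=1,\dots,n_i$.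
   Context: A derivation on a commutative $\mathbb{K}$-domain $B$ is a $\mathbb{K}$-linear map $D:B\to B$ satisfying the Leibniz rule; it is locally nilpotent if for each $b\in B$ there is a non-negative integer $n$ with $D^n(b)=0$. Elements $b_1,b_2\in B$ are relatively prime in $B$ if $(b_1)\cap(b_2)=(b_1b_2)$ as ideals of $B$.
   Formalization: The conclusion is asserted only for those i with f_i ≠ 0: since 0 is relatively prime to every element under the given definition, a row with f_i = 0 puts no constraint on its other factors and the claim fails there (e.g. b_11 = 0, b_12 = x in C[x]). *)

theory Defs
  imports Complex_Main "HOL-Computational_Algebra.Polynomial"
begin

(* A commutative K-domain: the field K is the type 'k, the integral domain B is the type 'b,
   and the K-algebra structure is the scalar multiplication. *)
locale commutative_domain_over = vector_space scale
  for scale :: "'k::field \<Rightarrow> 'b::idom \<Rightarrow> 'b" (infixr \<open>*s\<close> 75) +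
  assumes scale_mult_left: "(c *s x) * y = c *s (x * y)"
begin

definition derivation :: "('b \<Rightarrow> 'b) \<Rightarrow> bool" where
  "derivation D \<longleftrightarrow> Vector_Spaces.linear scale scale D \<and> (\<forall>x y. D (x * y) = D x * y + x * D y)"

definition locally_nilpotent_derivation :: "('b \<Rightarrow> 'b) \<Rightarrow> bool" where
  "locally_nilpotent_derivation D \<longleftrightarrow> derivation D \<and> (\<forall>x. \<exists>n. (D ^^ n) x = 0)"

end

definition Ker :: "('b \<Rightarrow> 'b::zero) \<Rightarrow> 'b set" where
  "Ker D = {x. D x = 0}"

definition principal_ideal :: "'b::comm_ring_1 \<Rightarrow> 'b set" where
  "principal_ideal x = range (\<lambda>y. x * y)"

(* Pitfall: (0) \<inter> (y) = (0) = (0 * y), so 0 is relatively prime to every element. *)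
definition relatively_prime :: "'b::comm_ring_1 \<Rightarrow> 'b \<Rightarrow> bool" where
  "relatively_prime x y \<longleftrightarrow> principal_ideal x \<inter> principal_ideal y = principal_ideal (x * y)"

end

theory Submission
  imports Defs "Jordan_Normal_Form.Determinant"
begin

text \<open>
  The degree \<open>ldeg x = max {n. D\<^sup>n x \<noteq> 0}\<close> behaves like the degree in a local slice, so a
  Mason--Stothers argument can be run inside \<open>B\<close>, with \<open>Ker D\<close> as the ring of constants.
  Let \<open>f\<^sub>0\<close> have maximal degree \<open>d\<close> among the nonzero \<open>f\<^sub>i\<close>, and choose a minimal set \<open>J\<close> of
  other indices such that a nonzero constant multiple of \<open>f\<^sub>0\<close> is a constant combination of the
  \<open>f\<^sub>i\<close> with \<open>i \<in> J\<close>. Put \<open>q = card J\<close>. By minimality the Wronskian of these \<open>f\<^sub>i\<close> is nonzero,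
  and up to a constant it is divisible by \<open>\<Prod>\<^sub>j b\<^sub>i\<^sub>j^(k\<^sub>i\<^sub>j - (q - 1))\<close> for every \<open>i\<close> in \<open>J\<close> and
  for \<open>i = 0\<close>. By coprimality it is divisible by the product of all of these. Since its degree is
  at most \<open>\<Sum>\<^sub>J ldeg f\<^sub>i - (q - 1)\<close>, comparing degrees gives
  \<open>d + (q - 1) \<le> (q - 1) \<Sum> ldeg b\<^sub>i\<^sub>j \<le> (q - 1) d \<Sum> 1 / k\<^sub>i\<^sub>j \<le> d\<close>. Hence \<open>q = 1\<close>, and then
  the first inequality says \<open>d = 0\<close>.
\<close>

section \<open>Relatively prime elements of a domain\<close>

lemma relatively_prime_iff:
  "relatively_prime x y \<longleftrightarrow> (\<forall>z. x dvd z \<longrightarrow> y dvd z \<longrightarrow> x * y dvd z)"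
proof -
  have ideal: "principal_ideal u = {z. u dvd z}" for u :: 'a
    by (auto simp: principal_ideal_def dvd_def)
  show ?thesis
    unfolding relatively_prime_def ideal by (auto dest: dvd_mult_left dvd_mult_right)
qed

lemma relatively_prime_commute: "relatively_prime x y \<longleftrightarrow> relatively_prime y x"
  by (auto simp: relatively_prime_iff mult.commute)

text \<open>Multiply the common multiple \<open>z\<close> by the cofactor \<open>v\<close> of
  \<open>u\<close> in \<open>x\<close>, then cancel \<open>v\<close>. Without
  \<open>x \<noteq> 0\<close> this fails, as every \<open>u\<close> divides
  \<open>0\<close>.\<close>

lemma relatively_prime_dvd_left:
  fixes x y :: "'a::idom"
  assumes "relatively_prime x y" "x \<noteq> 0" "u dvd x"
  shows "relatively_prime u y"
  unfolding relatively_prime_iff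
proof (intro allI impI)
  fix z assume z: "u dvd z" "y dvd z"
  obtain v where v: "x = u * v" using \<open>u dvd x\<close> by blast
  have "x dvd v * z" "y dvd v * z"
    using z by (auto simp: v mult.commute intro: mult_dvd_mono)
  then have "x * y dvd v * z"
    using assms(1) by (simp add: relatively_prime_iff)
  then have "v * (u * y) dvd v * z" by (simp add: v ac_simps)
  then show "u * y dvd z" using \<open>x \<noteq> 0\<close> v by simp
qed

text \<open>Write the common multiple as \<open>y1 * w\<close>: primality to \<open>y1\<close> makes
  \<open>x\<close> divide \<open>w\<close>, and primality to \<open>y2\<close> then applies to
  \<open>w\<close>.\<close>

lemma relatively_prime_mult_right:
  fixes x y1 y2 :: "'a::idom"
  assumes "relatively_prime x y1" "relatively_prime x y2"
  shows "relatively_prime x (y1 * y2)"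
  unfolding relatively_prime_iff
proof (intro allI impI)
  fix z assume z: "x dvd z" "y1 * y2 dvd z"
  show "x * (y1 * y2) dvd z"
  proof (cases "y1 = 0")
    case True
    then show ?thesis using z by simp
  next
    case False
    obtain w where w: "z = y1 * w" using z(2) by (metis dvd_mult_left dvd_def)
    have "x * y1 dvd y1 * w"
      using assms(1) z w by (auto simp: relatively_prime_iff)
    then have "x dvd w" using False by (simp add: mult.commute)
    moreover have "y2 dvd w" using z(2) False by (simp add: w)
    ultimately have "x * y2 dvd w" using assms(2) by (simp add: relatively_prime_iff)
    then have "y1 * (x * y2) dvd z" by (simp add: w)
    then show ?thesis by (simp add: ac_simps)
  qed
qed

lemma relatively_prime_prod_right:
  fixes x :: "'a::idom"
  assumes "\<And>j. j \<in> J \<Longrightarrow> relatively_prime x (g j)"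
  shows "relatively_prime x (prod g J)"
  using assms
proof (induction J rule: infinite_finite_induct)
  case (insert j J)
  then show ?case by (simp add: relatively_prime_mult_right)
qed (auto simp: relatively_prime_iff)

text \<open>Every term of the Leibniz expansion takes one entry from each column and so collects all
  the factors \<open>g j\<close>.\<close>

lemma prod_dvd_det:
  fixes A :: "'a::comm_ring_1 mat"
  assumes A: "A \<in> carrier_mat n n" and g: "\<And>i j. i < n \<Longrightarrow> j < n \<Longrightarrow> g j dvd A $$ (i, j)"
  shows "(\<Prod>j<n. g j) dvd det A"
  unfolding det_col[OF A]
proof (rule dvd_sum)
  fix p assume p: "p \<in> {p. p permutes {0..<n}}"
  have "(\<Prod>j<n. g j) dvd (\<Prod>j<n. A $$ (p j, j))"
  proof (rule prod_dvd_prod)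
    fix j assume "j \<in> {..<n}"
    then have "p j < n" using p permutes_in_image[of p "{0..<n}" j] by simp
    then show "g j dvd A $$ (p j, j)" using g \<open>j \<in> {..<n}\<close> by simp
  qed
  then show "(\<Prod>j<n. g j) dvd signof p * (\<Prod>j<n. A $$ (p j, j))" by simp
qed

section \<open>Locally nilpotent derivations and their iterates\<close>

text \<open>\<open>of_nat_neq_0\<close> expresses characteristic zero inside the ring; it keeps the
  binomial coefficient of a top Leibniz term from vanishing.\<close>

locale lnd =
  fixes D :: "'b::idom \<Rightarrow> 'b"
  assumes D_add: "D (x + y) = D x + D y"
    and D_mult: "D (x * y) = D x * y + x * D y"
    and nilpotent: "\<exists>n. (D ^^ n) x = 0"
    and of_nat_neq_0: "0 < n \<Longrightarrow> of_nat n \<noteq> (0::'b)"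
begin

lemma D_0 [simp]: "D 0 = 0"
  using D_add[of 0 0] by (metis add_cancel_left_right)

lemma D_minus [simp]: "D (- x) = - D x"
  using D_add[of x "- x"] by (simp add: eq_neg_iff_add_eq_0 add.commute)

lemma D_1 [simp]: "D 1 = 0"
  using D_mult[of 1 1] by (metis add_cancel_left_right mult_1 mult_1_right)

lemma D_diff: "D (x - y) = D x - D y"
  using D_add[of x "- y"] by simp

lemma D_sum: "D (\<Sum>x\<in>S. h x) = (\<Sum>x\<in>S. D (h x))"
  by (induction S rule: infinite_finite_induct) (auto simp: D_add)

lemma Dpow_0 [simp]: "(D ^^ n) 0 = 0"
  by (induction n) auto

lemma Dpow_add: "(D ^^ n) (x + y) = (D ^^ n) x + (D ^^ n) y"
  by (induction n) (auto simp: D_add)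

lemma Dpow_minus [simp]: "(D ^^ n) (- x) = - (D ^^ n) x"
  by (induction n) auto

lemma Dpow_sum: "(D ^^ n) (\<Sum>x\<in>S. h x) = (\<Sum>x\<in>S. (D ^^ n) (h x))"
  by (induction S rule: infinite_finite_induct) (auto simp: Dpow_add)

lemma Dpow_const_mult: "D c = 0 \<Longrightarrow> (D ^^ n) (c * x) = c * (D ^^ n) x"
  by (induction n) (auto simp: D_mult)

lemma Dpow_Suc: "(D ^^ Suc n) x = (D ^^ n) (D x)"
  by (simp add: funpow_swap1)

text \<open>All other terms of the Leibniz formula differentiate \<open>x\<close> more than
  \<open>n\<close> times or \<open>y\<close> more than \<open>p\<close> times. The induction peels
  off one \<open>D\<close> and adds the two coefficients by Pascal's rule.\<close>

lemma Dpow_mult_top: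
  assumes "(D ^^ Suc n) x = 0" "(D ^^ Suc p) y = 0"
  shows "(D ^^ (n + p)) (x * y) = of_nat ((n + p) choose n) * ((D ^^ n) x * (D ^^ p) y)"
  using assms
proof (induction "n + p" arbitrary: n p x y)
  case 0
  then show ?case by simp
next
  case (Suc N)
  consider "n = 0" | "p = 0" | n' p' where "n = Suc n'" "p = Suc p'"
    by (metis not0_implies_Suc)
  then show ?case
  proof cases
    case 1
    then show ?thesis using Suc.prems by (simp add: Dpow_const_mult)
  next
    case 2
    then show ?thesis
      using Suc.prems Dpow_const_mult[of y n x] by (simp add: mult.commute)
  next
    case 3
    have N: "N = n' + p" "N = n + p'" using Suc.hyps(2) 3 by auto
    have "(D ^^ (n + p)) (x * y) = (D ^^ (n' + p)) (D x * y) + (D ^^ (n + p')) (x * D y)"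
      using N Suc.hyps(2)[symmetric] by (simp only: Dpow_Suc D_mult Dpow_add)
    also have "(D ^^ (n' + p)) (D x * y) =
        of_nat ((n' + p) choose n') * ((D ^^ n') (D x) * (D ^^ p) y)"
      by (rule Suc.hyps(1)) (use N Suc.prems 3 Dpow_Suc in auto)
    also have "(D ^^ (n + p')) (x * D y) =
        of_nat ((n + p') choose n) * ((D ^^ n) x * (D ^^ p') (D y))"
      by (rule Suc.hyps(1)) (use N Suc.prems 3 Dpow_Suc in auto)
    also have "(D ^^ n') (D x) = (D ^^ n) x" by (simp only: 3 Dpow_Suc)
    also have "(D ^^ p') (D y) = (D ^^ p) y" by (simp only: 3 Dpow_Suc)
    also have "of_nat ((n' + p) choose n') * ((D ^^ n) x * (D ^^ p) y) +
        of_nat ((n + p') choose n) * ((D ^^ n) x * (D ^^ p) y) =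
        of_nat (((n' + p) choose n') + ((n + p') choose n)) * ((D ^^ n) x * (D ^^ p) y)"
      by (simp add: algebra_simps)
    also have "((n' + p) choose n') + ((n + p') choose n) = (n + p) choose n"
      using 3 by simp
    finally show ?thesis .
  qed
qed

section \<open>The degree of an element\<close>

text \<open>With \<open>Suc n\<close> the value at \<open>0\<close> is \<open>0\<close> rather than
  minus infinity, so the product rules ask for nonzero factors.\<close>

definition ldeg :: "'b \<Rightarrow> nat" where
  "ldeg x = (LEAST n. (D ^^ Suc n) x = 0)"

lemma Dpow_Suc_ldeg: "(D ^^ Suc (ldeg x)) x = 0"
proof -
  obtain n where "(D ^^ n) x = 0" using nilpotent by blast
  then have "(D ^^ Suc n) x = 0" by simp
  then show ?thesis unfolding ldeg_def by (rule LeastI)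
qed

lemma Dpow_eq_0_mono: "(D ^^ n) x = 0 \<Longrightarrow> n \<le> m \<Longrightarrow> (D ^^ m) x = 0"
  by (metis Dpow_0 comp_apply funpow_add le_add_diff_inverse2)

lemma ldeg_le_iff: "ldeg x \<le> n \<longleftrightarrow> (D ^^ Suc n) x = 0"
proof
  assume "ldeg x \<le> n"
  then show "(D ^^ Suc n) x = 0" using Dpow_eq_0_mono[OF Dpow_Suc_ldeg] by blast
next
  assume "(D ^^ Suc n) x = 0"
  then show "ldeg x \<le> n" unfolding ldeg_def by (rule Least_le)
qed

lemma Dpow_ldeg_nonzero: "x \<noteq> 0 \<Longrightarrow> (D ^^ ldeg x) x \<noteq> 0"
  using ldeg_le_iff[of x "ldeg x - 1"] by (cases "ldeg x") auto

lemma ldeg_eqI: "(D ^^ n) x \<noteq> 0 \<Longrightarrow> (D ^^ Suc n) x = 0 \<Longrightarrow> ldeg x = n"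
  using ldeg_le_iff[of x n] Dpow_eq_0_mono[OF Dpow_Suc_ldeg, of x n] by fastforce

lemma ldeg_0 [simp]: "ldeg 0 = 0"
  using ldeg_le_iff[of 0 0] by simp

lemma ldeg_eq_0_iff: "ldeg x = 0 \<longleftrightarrow> D x = 0"
  using ldeg_le_iff[of x 0] by simp

lemma ldeg_minus [simp]: "ldeg (- x) = ldeg x"
  by (simp add: ldeg_def)

text \<open>The top derivatives of \<open>x\<close> and \<open>y\<close> are nonzero constants, so
  their product with a binomial coefficient is again a nonzero constant.\<close>

lemma ldeg_mult:
  assumes "x \<noteq> 0" "y \<noteq> 0"
  shows "ldeg (x * y) = ldeg x + ldeg y"
proof (rule ldeg_eqI)
  let ?n = "ldeg x" and ?p = "ldeg y"
  have top: "(D ^^ (?n + ?p)) (x * y) =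
      of_nat ((?n + ?p) choose ?n) * ((D ^^ ?n) x * (D ^^ ?p) y)"
    by (rule Dpow_mult_top[OF Dpow_Suc_ldeg Dpow_Suc_ldeg])
  show "(D ^^ (?n + ?p)) (x * y) \<noteq> 0"
    unfolding top using of_nat_neq_0[of "(?n + ?p) choose ?n"] Dpow_ldeg_nonzero assms by simp
  have "D ((D ^^ ?n) x) = 0" "D ((D ^^ ?p) y) = 0"
    using Dpow_Suc_ldeg[of x] Dpow_Suc_ldeg[of y] by auto
  moreover have "D (of_nat k) = 0" for k by (induction k) (auto simp: D_add)
  ultimately show "(D ^^ Suc (?n + ?p)) (x * y) = 0"
    by (simp add: top D_mult)
qed

lemma ldeg_power: "x \<noteq> 0 \<Longrightarrow> ldeg (x ^ n) = n * ldeg x"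
  by (induction n) (auto simp: ldeg_mult ldeg_eq_0_iff)

lemma ldeg_prod: "(\<And>x. x \<in> S \<Longrightarrow> h x \<noteq> 0) \<Longrightarrow> ldeg (prod h S) = (\<Sum>x\<in>S. ldeg (h x))"
  by (induction S rule: infinite_finite_induct) (auto simp: ldeg_mult ldeg_eq_0_iff)

lemma ldeg_sum_le: "(\<And>x. x \<in> S \<Longrightarrow> ldeg (h x) \<le> n) \<Longrightarrow> ldeg (sum h S) \<le> n"
  unfolding ldeg_le_iff Dpow_sum by (rule sum.neutral) blast

lemma ldeg_Dpow: "(D ^^ i) x \<noteq> 0 \<Longrightarrow> ldeg ((D ^^ i) x) + i = ldeg x"
proof (induction i)
  case (Suc i)
  have nz: "(D ^^ i) x \<noteq> 0" using Suc.prems by auto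
  obtain n where n: "ldeg ((D ^^ i) x) = Suc n"
    using ldeg_eq_0_iff[of "(D ^^ i) x"] Suc.prems by (cases "ldeg ((D ^^ i) x)") auto
  have "ldeg ((D ^^ Suc i) x) = n"
  proof (rule ldeg_eqI)
    have "(D ^^ m) ((D ^^ Suc i) x) = (D ^^ Suc m) ((D ^^ i) x)" for m
      by (simp only: Dpow_Suc funpow.simps(2)[of i] o_apply)
    then show "(D ^^ n) ((D ^^ Suc i) x) \<noteq> 0" "(D ^^ Suc n) ((D ^^ Suc i) x) = 0"
      using Dpow_ldeg_nonzero[OF nz] Dpow_Suc_ldeg[of "(D ^^ i) x"] unfolding n by metis+
  qed
  then show ?case using n Suc.IH[OF nz] by simp
qed simp

text \<open>In the fraction field the hypothesis says that \<open>w / v\<close> is a constant.\<close>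

lemma mult_Dpow_commute:
  assumes "v \<noteq> 0" and vw: "v * D w = w * D v"
  shows "v * (D ^^ n) w = w * (D ^^ n) v"
proof (induction n)
  case (Suc n)
  let ?v = "(D ^^ n) v" and ?w = "(D ^^ n) w"
  \<comment> \<open>Differentiate the induction hypothesis and multiply by \<open>v\<close>; the
    terms in \<open>D v\<close> and \<open>D w\<close> then agree and cancel.\<close>
  have "D (v * ?w) = D (w * ?v)" using Suc by simp
  then have 1: "v * (D v * ?w + v * D ?w) = v * (D w * ?v + w * D ?v)" by (simp add: D_mult)
  have "v * (D v * ?w) = D v * (w * ?v)" using Suc by (simp add: algebra_simps)
  also have "\<dots> = v * (D w * ?v)" using vw by (simp add: algebra_simps)
  finally have "v * (v * D ?w) = v * (w * D ?v)" using 1 by (simp only: distrib_left add_left_cancel)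
  then show ?case using assms(1) by simp
qed (simp add: mult.commute)

section \<open>Wronskians over the ring of constants\<close>

definition wronskian_mat :: "nat \<Rightarrow> (nat \<Rightarrow> 'b) \<Rightarrow> 'b mat" where
  "wronskian_mat q h = mat q q (\<lambda>(i, j). (D ^^ i) (h j))"

lemma wronskian_mat_carrier [simp]: "wronskian_mat q h \<in> carrier_mat q q"
  by (simp add: wronskian_mat_def)

lemma wronskian_mat_mult_vec:
  assumes "i < q"
  shows "(wronskian_mat q h *\<^sub>v vec q v) $ i = (\<Sum>j<q. (D ^^ i) (h j) * v j)"
  using assms
  by (simp add: wronskian_mat_def scalar_prod_def lessThan_atLeast0)

lemma det_wronskian_eq_0_iff:
  "det (wronskian_mat q h) = 0 \<longleftrightarrow>
    (\<exists>v. (\<exists>j<q. v j \<noteq> 0) \<and> (\<forall>i<q. (\<Sum>j<q. (D ^^ i) (h j) * v j) = 0))"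
  (is "?L \<longleftrightarrow> ?R")
proof
  assume ?L
  then obtain x where x: "x \<in> carrier_vec q" "x \<noteq> 0\<^sub>v q" "wronskian_mat q h *\<^sub>v x = 0\<^sub>v q"
    using det_0_iff_vec_prod_zero[OF wronskian_mat_carrier] by blast
  have x': "x = vec q (\<lambda>j. x $ j)" using x(1) by auto
  have "\<exists>j<q. x $ j \<noteq> 0" using x(1,2) by (metis carrier_vecD eq_vecI index_zero_vec)
  moreover have "(\<Sum>j<q. (D ^^ i) (h j) * x $ j) = 0" if "i < q" for i
    using x(3) wronskian_mat_mult_vec[OF that, of h "\<lambda>j. x $ j"] x' that by simp
  ultimately show ?R by blast
next
  assume ?R
  then obtain v where v: "\<exists>j<q. v j \<noteq> 0" "\<forall>i<q. (\<Sum>j<q. (D ^^ i) (h j) * v j) = 0" by blast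
  have "vec q v \<noteq> 0\<^sub>v q" using v(1) by (metis index_vec index_zero_vec(1))
  moreover have "wronskian_mat q h *\<^sub>v vec q v = 0\<^sub>v q"
    using v(2) wronskian_mat_mult_vec
    by (intro eq_vecI) (auto simp: wronskian_mat_def simp flip: wronskian_mat_mult_vec)
  ultimately show ?L
    using det_0_iff_vec_prod_zero[OF wronskian_mat_carrier] vec_carrier by blast
qed

text \<open>If the Wronskian of the first \<open>q\<close> elements vanishes, induction applies.
  Otherwise a kernel vector \<open>v\<close> has a nonzero last entry, and differentiating its
  relations shows that \<open>v\<close> is proportional to a vector of constants.\<close>

lemma det_wronskian_eq_0_imp_dependent:
  assumes "det (wronskian_mat q h) = 0"
  shows "\<exists>e. (\<forall>j<q. D (e j) = 0) \<and> (\<exists>j<q. e j \<noteq> 0) \<and> (\<Sum>j<q. e j * h j) = 0"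
  using assms
proof (induction q)
  case 0
  then show ?case by (simp add: wronskian_mat_def)
next
  case (Suc q)
  show ?case
  proof (cases "det (wronskian_mat q h) = 0")
    case True
    then obtain e where e: "\<forall>j<q. D (e j) = 0" "\<exists>j<q. e j \<noteq> 0" "(\<Sum>j<q. e j * h j) = 0"
      using Suc.IH by blast
    have "(\<Sum>j<Suc q. (e(q := 0)) j * h j) = 0" using e(3) by simp
    moreover have "\<forall>j<Suc q. D ((e(q := 0)) j) = 0" using e(1) by auto
    moreover have "\<exists>j<Suc q. (e(q := 0)) j \<noteq> 0" using e(2) by force
    ultimately show ?thesis by blast
  next
    case False
    obtain v where v: "\<exists>j<Suc q. v j \<noteq> 0"
      and rel: "\<And>i. i < Suc q \<Longrightarrow> (\<Sum>j<Suc q. (D ^^ i) (h j) * v j) = 0"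
      using Suc.prems det_wronskian_eq_0_iff by blast
    have vq: "v q \<noteq> 0"
    proof
      assume "v q = 0"
      then have "\<exists>j<q. v j \<noteq> 0" "\<forall>i<q. (\<Sum>j<q. (D ^^ i) (h j) * v j) = 0"
        using v rel less_Suc_eq by auto
      then show False using False det_wronskian_eq_0_iff by blast
    qed
    \<comment> \<open>The derivative of relation \<open>i\<close> splits into relation
      \<open>Suc i\<close>, still in range as \<open>i < q\<close>, and the sum wanted.\<close>
    have relD: "(\<Sum>j<Suc q. (D ^^ i) (h j) * D (v j)) = 0" if "i < q" for i
    proof -
      have "0 = D (\<Sum>j<Suc q. (D ^^ i) (h j) * v j)" using rel that by simp
      also have "\<dots> = (\<Sum>j<Suc q. (D ^^ Suc i) (h j) * v j)
          + (\<Sum>j<Suc q. (D ^^ i) (h j) * D (v j))"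
        by (simp add: D_sum D_mult sum.distrib D_add)
      finally show ?thesis using rel[of "Suc i"] that by simp
    qed
    \<comment> \<open>The numerator of the derivative of \<open>v j / v q\<close>. Since
      \<open>u q = 0\<close>, the nonzero smaller Wronskian forces the rest to vanish.\<close>
    define u where "u j = v q * D (v j) - v j * D (v q)" for j
    have "(\<Sum>j<q. (D ^^ i) (h j) * u j) = 0" if "i < q" for i
    proof -
      have "(\<Sum>j<q. (D ^^ i) (h j) * u j) = (\<Sum>j<Suc q. (D ^^ i) (h j) * u j)"
        by (simp add: u_def)
      also have "\<dots> = v q * (\<Sum>j<Suc q. (D ^^ i) (h j) * D (v j))
          - D (v q) * (\<Sum>j<Suc q. (D ^^ i) (h j) * v j)"
        unfolding u_def sum_distrib_left sum_subtractf[symmetric]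
        by (rule sum.cong) (auto simp: algebra_simps)
      also have "\<dots> = 0" using relD[OF that] rel[of i] that by simp
      finally show ?thesis .
    qed
    then have u0: "u j = 0" if "j < q" for j
      using False det_wronskian_eq_0_iff that by blast
    have vj: "v q * D (v j) = v j * D (v q)" if "j < Suc q" for j
      using u0[of j] that less_Suc_eq by (auto simp: u_def)
    \<comment> \<open>Differentiating as often as the degree of \<open>v q\<close> keeps the
      constant ratios \<open>v j / v q\<close> and turns the entries into constants inside the ring,
      with \<open>e q\<close> nonzero.\<close>
    define e where "e j = (D ^^ ldeg (v q)) (v j)" for j
    have e: "v q * e j = v j * e q" if "j < Suc q" for j
      unfolding e_def by (rule mult_Dpow_commute[OF vq vj[OF that]])
    have "D (e j) = 0" if "j < Suc q" for j
    proof -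
      have "v q * (D ^^ Suc (ldeg (v q))) (v j) = 0"
        using mult_Dpow_commute[OF vq vj[OF that], of "Suc (ldeg (v q))"]
        by (simp only: Dpow_Suc_ldeg mult_zero_right)
      then show ?thesis using vq by (simp add: e_def)
    qed
    moreover have "e q \<noteq> 0" unfolding e_def by (rule Dpow_ldeg_nonzero[OF vq])
    moreover have "(\<Sum>j<Suc q. e j * h j) = 0"
    proof -
      have "v q * (\<Sum>j<Suc q. e j * h j) = (\<Sum>j<Suc q. (v q * e j) * h j)"
        by (simp only: sum_distrib_left mult.assoc)
      also have "\<dots> = (\<Sum>j<Suc q. e q * ((D ^^ 0) (h j) * v j))"
        by (rule sum.cong) (auto simp: e)
      also have "\<dots> = e q * (\<Sum>j<Suc q. (D ^^ 0) (h j) * v j)"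
        by (simp only: sum_distrib_left)
      also have "\<dots> = 0" using rel[of 0] by simp
      finally show ?thesis using vq by simp
    qed
    ultimately show ?thesis by blast
  qed
qed

text \<open>Row \<open>i\<close> lowers degrees by \<open>i\<close>, so each nonzero Leibniz term
  loses \<open>0 + ... + (q - 1)\<close> in total, of which only \<open>q - 1\<close> is
  kept.\<close>

lemma ldeg_det_wronskian:
  assumes "det (wronskian_mat q h) \<noteq> 0"
  shows "ldeg (det (wronskian_mat q h)) + (q - 1) \<le> (\<Sum>j<q. ldeg (h j))"
proof -
  let ?t = "\<lambda>p. \<Prod>i = 0..<q. (D ^^ i) (h (p i))"
  have det: "det (wronskian_mat q h) = (\<Sum>p | p permutes {0..<q}. signof p * ?t p)"
    unfolding det_def'[OF wronskian_mat_carrier]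
  proof (intro sum.cong refl arg_cong2[of _ _ _ _ "(*)"] prod.cong)
    fix p i assume p: "p \<in> {p. p permutes {0..<q}}" "i \<in> {0..<q}"
    then have "p i < q" using permutes_in_image[of p "{0..<q}" i] by simp
    then show "wronskian_mat q h $$ (i, p i) = (D ^^ i) (h (p i))"
      using p by (simp add: wronskian_mat_def)
  qed
  have bound: "ldeg (?t p) + (q - 1) \<le> (\<Sum>j<q. ldeg (h j))"
    if p: "p permutes {0..<q}" and nz: "?t p \<noteq> 0" for p
  proof -
    have "ldeg (?t p) + (\<Sum>i = 0..<q. i) = (\<Sum>i = 0..<q. ldeg ((D ^^ i) (h (p i))) + i)"
      using nz by (subst ldeg_prod) (auto simp: sum.distrib)
    also have "\<dots> = (\<Sum>i = 0..<q. ldeg (h (p i)))"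
      using nz by (intro sum.cong) (auto intro!: ldeg_Dpow)
    also have "\<dots> = (\<Sum>j = 0..<q. ldeg (h j))"
      using sum.permute[OF p, of "\<lambda>j. ldeg (h j)"] by (simp add: o_def)
    finally have "ldeg (?t p) + (\<Sum>i = 0..<q. i) = (\<Sum>j<q. ldeg (h j))"
      by (simp add: lessThan_atLeast0)
    moreover have "q - 1 \<le> (\<Sum>i = 0..<q. i)"
      by (cases q) auto
    ultimately show ?thesis by linarith
  qed
  \<comment> \<open>The bound for one nonzero term ensures that subtracting \<open>q - 1\<close>
    below does not truncate.\<close>
  have "\<exists>p. p permutes {0..<q} \<and> ?t p \<noteq> 0"
  proof (rule ccontr)
    assume "\<not> ?thesis"
    then have "det (wronskian_mat q h) = 0" unfolding det by (intro sum.neutral) auto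
    then show False using assms by simp
  qed
  then have q: "q - 1 \<le> (\<Sum>j<q. ldeg (h j))" using bound by fastforce
  have "ldeg (det (wronskian_mat q h)) \<le> (\<Sum>j<q. ldeg (h j)) - (q - 1)"
    unfolding det
  proof (rule ldeg_sum_le)
    fix p assume p: "p \<in> {p. p permutes {0..<q}}"
    have "ldeg (signof p * ?t p) = ldeg (?t p)"
      by (cases p rule: sign_cases) auto
    also have "\<dots> \<le> (\<Sum>j<q. ldeg (h j)) - (q - 1)"
    proof (cases "?t p = 0")
      case True
      then show ?thesis by (simp only: ldeg_0 le0)
    next
      case False
      then have "ldeg (?t p) + (q - 1) \<le> (\<Sum>j<q. ldeg (h j))" using bound p by blast
      then show ?thesis by linarith
    qed
    finally show "ldeg (signof p * ?t p) \<le> (\<Sum>j<q. ldeg (h j)) - (q - 1)" .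
  qed
  then show ?thesis using q by linarith
qed

section \<open>Power factors that survive differentiation\<close>

text \<open>By the Leibniz rule one differentiation costs at most one power of each factor;
  truncated subtraction covers exponent \<open>0\<close>.\<close>

lemma prod_power_dvd_D:
  assumes "(\<Prod>j\<in>S. b j ^ e j) dvd x"
  shows "(\<Prod>j\<in>S. b j ^ (e j - 1)) dvd D x"
proof -
  have power: "b ^ (n - 1) dvd D (b ^ n)" for b n
  proof (induction n)
    case (Suc n)
    have "b ^ n dvd b * D (b ^ n)" using Suc by (cases n) auto
    then show ?case by (simp add: D_mult)
  qed simp
  have prod: "(\<Prod>j\<in>S. b j ^ (e j - 1)) dvd D (\<Prod>j\<in>S. b j ^ e j)"
  proof (induction S rule: infinite_finite_induct)
    case (insert j S)
    have "(\<Prod>j\<in>S. b j ^ (e j - 1)) dvd (\<Prod>j\<in>S. b j ^ e j)"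
      by (intro prod_dvd_prod le_imp_power_dvd) auto
    moreover have "b j ^ (e j - 1) dvd b j ^ e j" by (intro le_imp_power_dvd) auto
    ultimately show ?case
      using insert power by (auto simp: D_mult intro!: dvd_add mult_dvd_mono)
  qed auto
  have sub: "(\<Prod>j\<in>S. b j ^ (e j - 1)) dvd (\<Prod>j\<in>S. b j ^ e j)"
    by (intro prod_dvd_prod le_imp_power_dvd) auto
  obtain y where "x = (\<Prod>j\<in>S. b j ^ e j) * y" using assms by blast
  then show ?thesis using prod sub by (auto simp: D_mult intro!: dvd_add)
qed

text \<open>The common bound \<open>r\<close> yields one divisor for all entries of a Wronskian
  column.\<close>

lemma prod_power_dvd_Dpow:
  assumes "(\<Prod>j\<in>S. b j ^ e j) dvd x" "l \<le> r"
  shows "(\<Prod>j\<in>S. b j ^ (e j - r)) dvd (D ^^ l) x"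
proof -
  have "(\<Prod>j\<in>S. b j ^ (e j - l)) dvd (D ^^ l) x"
  proof (induction l)
    case (Suc l)
    then show ?case using prod_power_dvd_D[of b "\<lambda>j. e j - l" S] by simp
  qed (use assms in simp)
  moreover have "(\<Prod>j\<in>S. b j ^ (e j - r)) dvd (\<Prod>j\<in>S. b j ^ (e j - l))"
    using assms(2) by (intro prod_dvd_prod le_imp_power_dvd) auto
  ultimately show ?thesis by (rule dvd_trans[rotated])
qed

section \<open>Minimal relations with constant coefficients\<close>

text \<open>Take \<open>J\<close> of least cardinality carrying a relation with nonzero coefficient
  at \<open>x\<close>. A zero coefficient, or a dependence among the \<open>f j\<close>, would allow
  an index to be removed.\<close>

lemma obtain_independent_relation:
  assumes "finite K" "x + (\<Sum>j\<in>K. f j) = 0"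
  obtains J c0 c where "J \<subseteq> K" "c0 \<noteq> 0" "D c0 = 0" "\<forall>j\<in>J. D (c j) = 0 \<and> c j \<noteq> 0"
    "c0 * x + (\<Sum>j\<in>J. c j * f j) = 0"
    "\<forall>e. (\<forall>j\<in>J. D (e j) = 0) \<and> (\<Sum>j\<in>J. e j * f j) = 0 \<longrightarrow> (\<forall>j\<in>J. e j = 0)"
proof -
  define P where "P J \<longleftrightarrow> J \<subseteq> K \<and> (\<exists>c0 c. c0 \<noteq> 0 \<and> D c0 = 0 \<and> (\<forall>j\<in>J. D (c j) = 0) \<and>
    c0 * x + (\<Sum>j\<in>J. c j * f j) = 0)" for J
  have "P K" unfolding P_def
    by (rule conjI[OF subset_refl], rule exI[of _ 1], rule exI[of _ "\<lambda>_. 1"]) (use assms in auto)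
  then obtain J where J: "P J" "\<And>J'. P J' \<Longrightarrow> card J \<le> card J'"
    using ex_has_least_nat[of P K card] by blast
  then obtain c0 c where c: "J \<subseteq> K" "c0 \<noteq> 0" "D c0 = 0" "\<And>j. j \<in> J \<Longrightarrow> D (c j) = 0"
    "c0 * x + (\<Sum>j\<in>J. c j * f j) = 0" unfolding P_def by blast
  have fin: "finite J" using c(1) assms(1) by (rule finite_subset)
  have not_P: "\<not> P (J - {j})" if "j \<in> J" for j
    using J(2)[of "J - {j}"] that fin card_gt_0_iff[of J] by (auto simp: card_Diff_singleton)
  have c_nz: "c j \<noteq> 0" if "j \<in> J" for j
  proof
    assume "c j = 0"
    then have "(\<Sum>j\<in>J. c j * f j) = (\<Sum>j\<in>J - {j}. c j * f j)"
      using sum.remove[OF fin that, of "\<lambda>j. c j * f j"] by simp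
    then have "c0 * x + (\<Sum>j\<in>J - {j}. c j * f j) = 0" using c(5) by simp
    moreover have "J - {j} \<subseteq> K" "\<forall>i\<in>J - {j}. D (c i) = 0" using c by auto
    ultimately have "P (J - {j})" unfolding P_def using c(2,3) by blast
    then show False using not_P that by blast
  qed
  have indep: "e j = 0"
    if e: "\<And>j. j \<in> J \<Longrightarrow> D (e j) = 0" "(\<Sum>j\<in>J. e j * f j) = 0" and j: "j \<in> J" for e j
  proof (rule ccontr)
    assume nz: "e j \<noteq> 0"
    \<comment> \<open>Elimination of index \<open>j\<close> between the two relations:
      \<open>c' j = 0\<close>, while \<open>x\<close> gets the nonzero coefficient
      \<open>e j * c0\<close>.\<close>
    define c' where "c' i = e j * c i - c j * e i" for i
    have "(\<Sum>i\<in>J - {j}. c' i * f i) = (\<Sum>i\<in>J. c' i * f i)"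
      using sum.remove[OF fin j, of "\<lambda>i. c' i * f i"] by (simp add: c'_def)
    also have "\<dots> = e j * (\<Sum>i\<in>J. c i * f i) - c j * (\<Sum>i\<in>J. e i * f i)"
      unfolding sum_distrib_left sum_subtractf[symmetric] c'_def
      by (rule sum.cong) (auto simp: algebra_simps)
    finally have "(e j * c0) * x + (\<Sum>i\<in>J - {j}. c' i * f i)
        = e j * (c0 * x + (\<Sum>i\<in>J. c i * f i))"
      by (simp add: e(2) algebra_simps)
    then have "(e j * c0) * x + (\<Sum>i\<in>J - {j}. c' i * f i) = 0" using c(5) by simp
    moreover have "e j * c0 \<noteq> 0" "D (e j * c0) = 0" using nz c e j by (auto simp: D_mult)
    moreover have "\<forall>i\<in>J - {j}. D (c' i) = 0" using c(4) e(1) j by (auto simp: c'_def D_diff D_mult)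
    ultimately have "P (J - {j})" using c(1) unfolding P_def by blast
    then show False using not_P j by blast
  qed
  show ?thesis by (rule that[of J c0 c]) (use c c_nz indep in blast)+
qed

section \<open>The Mason-Stothers inequality\<close>

text \<open>The factors \<open>g i\<close> with \<open>i\<close> in the minimal set divide the
  Wronskian column by column; relative primality serves to add the factor \<open>g i0\<close>. The
  set returned also contains \<open>i0\<close>, so \<open>card J - 2\<close> is the highest order of
  differentiation.\<close>

lemma mason_inequality:
  fixes f :: "'i \<Rightarrow> 'b"
  assumes I: "finite I" "i0 \<in> I" "(\<Sum>i\<in>I. f i) = 0"
    and nz: "\<And>i. i \<in> I \<Longrightarrow> f i \<noteq> 0"
    and a: "\<And>i. i \<in> I \<Longrightarrow> D (a i) = 0"
    and f: "\<And>i. i \<in> I \<Longrightarrow> f i = a i * (\<Prod>j\<in>S i. b i j ^ k i j)"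
    and S: "\<And>i. i \<in> I \<Longrightarrow> finite (S i)"
    and k: "\<And>i j. i \<in> I \<Longrightarrow> j \<in> S i \<Longrightarrow> k i j > 0"
    and rp: "\<And>i. i \<in> I \<Longrightarrow> i \<noteq> i0 \<Longrightarrow> relatively_prime (f i0) (f i)"
  obtains J where "J \<subseteq> I" "i0 \<in> J" "2 \<le> card J"
    "ldeg (f i0) + (card J - 2) \<le> (card J - 2) * (\<Sum>i\<in>J. \<Sum>j\<in>S i. ldeg (b i j))"
proof -
  have "f i0 + (\<Sum>i\<in>I - {i0}. f i) = 0" using I by (simp add: sum.remove)
  then obtain J c0 c where J: "J \<subseteq> I - {i0}" and c0: "c0 \<noteq> 0" "D c0 = 0"
    and c: "\<forall>j\<in>J. D (c j) = 0 \<and> c j \<noteq> 0"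
    and rel: "c0 * f i0 + (\<Sum>j\<in>J. c j * f j) = 0"
    and indep: "\<forall>e. (\<forall>j\<in>J. D (e j) = 0) \<and> (\<Sum>j\<in>J. e j * f j) = 0 \<longrightarrow> (\<forall>j\<in>J. e j = 0)"
    by (rule obtain_independent_relation[OF finite_Diff[OF I(1)]])
  have finJ: "finite J" using J I(1) finite_subset by blast
  have J_nonempty: "J \<noteq> {}" using rel c0 nz[OF I(2)] by auto
  define q where "q = card J"
  have q: "q > 0" using J_nonempty finJ by (simp add: q_def card_gt_0_iff)
  obtain \<phi> where \<phi>: "bij_betw \<phi> {..<q} J"
    using ex_bij_betw_nat_finite[OF finJ] by (auto simp: q_def lessThan_atLeast0)
  have \<phi>_in: "\<phi> j \<in> J" if "j < q" for j using \<phi> that by (auto simp: bij_betw_def)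
  have sum_\<phi>: "(\<Sum>j<q. h (\<phi> j)) = (\<Sum>i\<in>J. h i)" for h :: "'i \<Rightarrow> 'b"
    by (rule sum.reindex_bij_betw[OF \<phi>])
  have b_nz: "b i j \<noteq> 0" if "i \<in> I" "j \<in> S i" for i j
    using nz[OF that(1)] k[OF that] S[OF that(1)] that by (auto simp: f)
  \<comment> \<open>A common divisor of all derivatives of \<open>f i\<close> of order below
    \<open>q\<close>.\<close>
  define g where "g i = (\<Prod>j\<in>S i. b i j ^ (k i j - (q - 1)))" for i
  have g_dvd: "g i dvd (D ^^ l) (f i)" if "i \<in> I" "l < q" for i l
    unfolding g_def by (rule prod_power_dvd_Dpow) (use that f in auto)
  have ldeg_g: "ldeg (f i) \<le> ldeg (g i) + (q - 1) * (\<Sum>j\<in>S i. ldeg (b i j))" if "i \<in> I" for i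
  proof -
    have "ldeg (f i) = (\<Sum>j\<in>S i. k i j * ldeg (b i j))"
      using nz[OF that] a[OF that] b_nz that f[OF that]
      by (subst f[OF that], subst ldeg_mult) (auto simp: ldeg_prod ldeg_power ldeg_eq_0_iff)
    also have "\<dots> \<le> (\<Sum>j\<in>S i. (k i j - (q - 1)) * ldeg (b i j) + (q - 1) * ldeg (b i j))"
      unfolding distrib_right[symmetric] by (intro sum_mono mult_right_mono) auto
    also have "\<dots> = ldeg (g i) + (q - 1) * (\<Sum>j\<in>S i. ldeg (b i j))"
      unfolding g_def using b_nz that
      by (simp add: ldeg_prod ldeg_power sum.distrib sum_distrib_left)
    finally show ?thesis .
  qed

  define A where "A = wronskian_mat q (\<lambda>j. f (\<phi> j))"
  have A: "A \<in> carrier_mat q q" by (simp add: A_def)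
  \<comment> \<open>A zero determinant would give a nontrivial constant relation over
    \<open>J\<close>, against \<open>indep\<close>; \<open>e'\<close> carries it from positions to
    indices.\<close>
  have det_nz: "det A \<noteq> 0"
  proof
    assume "det A = 0"
    then obtain e where e: "\<forall>j<q. D (e j) = 0" "\<exists>j<q. e j \<noteq> 0" "(\<Sum>j<q. e j * f (\<phi> j)) = 0"
      unfolding A_def using det_wronskian_eq_0_imp_dependent by blast
    define e' where "e' i = e (inv_into {..<q} \<phi> i)" for i
    have e': "e' (\<phi> j) = e j" if "j < q" for j
      unfolding e'_def using bij_betw_inv_into_left[OF \<phi>, of j] that by simp
    have "D (e' i) = 0" if "i \<in> J" for i
      using that \<phi> e(1) e' by (auto simp: bij_betw_def)
    moreover have "(\<Sum>i\<in>J. e' i * f i) = 0"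
      unfolding sum_\<phi>[symmetric] using e(3) e' by simp
    ultimately have "e' i = 0" if "i \<in> J" for i using indep that by blast
    then show False using e(2) e' \<phi>_in by metis
  qed

  text \<open>By Cramer's rule, \<open>c (\<phi> 0) * det A\<close> is the determinant of \<open>A\<close> with column \<open>0\<close>
    replaced by the derivatives of \<open>- c0 * f i0\<close>, so that \<open>g i0\<close> divides it as well.\<close>

  have "(\<Prod>j<q. g (\<phi> j)) dvd det A"
  proof (rule prod_dvd_det[OF A])
    fix i j assume "i < q" "j < q"
    then show "g (\<phi> j) dvd A $$ (i, j)"
      using g_dvd \<phi>_in J by (auto simp: A_def wronskian_mat_def)
  qed
  then have dvd_J: "prod g J dvd det A" by (simp add: prod.reindex_bij_betw[OF \<phi>])
  define x where "x = vec q (\<lambda>j. c (\<phi> j))"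
  have Ax: "g i0 dvd (A *\<^sub>v x) $ i" if "i < q" for i
  proof -
    have "(A *\<^sub>v x) $ i = (\<Sum>j<q. (D ^^ i) (f (\<phi> j)) * c (\<phi> j))"
      unfolding A_def x_def by (rule wronskian_mat_mult_vec[OF that])
    also have "\<dots> = (\<Sum>j\<in>J. (D ^^ i) (f j) * c j)" by (rule sum_\<phi>)
    also have "\<dots> = (D ^^ i) (\<Sum>j\<in>J. c j * f j)"
      unfolding Dpow_sum using c by (intro sum.cong) (auto simp: Dpow_const_mult mult.commute)
    also have "(\<Sum>j\<in>J. c j * f j) = c0 * (- f i0)"
      using rel by (simp add: eq_neg_iff_add_eq_0 add.commute)
    finally show ?thesis using g_dvd[OF I(2) that] by (simp add: Dpow_const_mult[OF c0(2)])
  qed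
  have "(\<Prod>j<q. if j = 0 then g i0 else 1) dvd det (replace_col A (A *\<^sub>v x) 0)"
    by (rule prod_dvd_det) (use A Ax in \<open>auto simp: replace_col_def\<close>)
  moreover have "(\<Prod>j<q. if j = 0 then g i0 else 1) = g i0"
    using q by (simp add: prod.delta)
  moreover have "det (replace_col A (A *\<^sub>v x) 0) = x $ 0 * det A"
    by (rule cramer_lemma_mat[OF A _ q]) (simp add: x_def)
  ultimately have dvd_i0: "g i0 dvd c (\<phi> 0) * det A" using q by (simp add: x_def)

  have g_f: "g i dvd f i" if "i \<in> I" for i using g_dvd[OF that q] by simp
  have "relatively_prime (g i0) (g i)" if "i \<in> J" for i
  proof -
    have i: "i \<in> I" "i \<noteq> i0" using that J by auto
    have "relatively_prime (g i0) (f i)"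
      by (rule relatively_prime_dvd_left[OF rp[OF i] nz[OF I(2)] g_f[OF I(2)]])
    then show ?thesis
      using relatively_prime_dvd_left[OF _ nz[OF i(1)] g_f[OF i(1)]] relatively_prime_commute
      by blast
  qed
  then have "relatively_prime (g i0) (prod g J)" by (rule relatively_prime_prod_right)
  then have "g i0 * prod g J dvd c (\<phi> 0) * det A"
    using dvd_i0 dvd_J by (simp add: relatively_prime_iff)
  then obtain y where y: "c (\<phi> 0) * det A = g i0 * prod g J * y" by blast
  have c_\<phi>: "c (\<phi> 0) \<noteq> 0" "D (c (\<phi> 0)) = 0" using c \<phi>_in[OF q] by auto
  have factors_nz: "g i0 * prod g J \<noteq> 0" "y \<noteq> 0" using y det_nz c_\<phi>(1) by auto
  have "ldeg (det A) = ldeg (c (\<phi> 0) * det A)"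
    using c_\<phi> det_nz by (simp add: ldeg_mult ldeg_eq_0_iff)
  also have "\<dots> = ldeg (g i0 * prod g J) + ldeg y"
    unfolding y using factors_nz by (rule ldeg_mult)
  also have "ldeg (g i0 * prod g J) = ldeg (g i0) + (\<Sum>i\<in>J. ldeg (g i))"
    using factors_nz(1) finJ by (subst ldeg_mult) (auto simp: ldeg_prod)
  \<comment> \<open>Here \<open>ldeg y\<close> is dropped. Below, \<open>ldeg_g\<close> bounds the
    right side, and the sums of \<open>ldeg (g i)\<close> cancel.\<close>
  finally have "ldeg (g i0) + (\<Sum>i\<in>J. ldeg (g i)) + (q - 1) \<le> (\<Sum>j<q. ldeg (f (\<phi> j)))"
    using ldeg_det_wronskian[OF det_nz[unfolded A_def], folded A_def] by linarith
  also have "\<dots> = (\<Sum>i\<in>J. ldeg (f i))" by (rule sum.reindex_bij_betw[OF \<phi>])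
  also have "\<dots> \<le> (\<Sum>i\<in>J. ldeg (g i) + (q - 1) * (\<Sum>j\<in>S i. ldeg (b i j)))"
    using J ldeg_g by (intro sum_mono) auto
  also have "\<dots> = (\<Sum>i\<in>J. ldeg (g i)) + (q - 1) * (\<Sum>i\<in>J. \<Sum>j\<in>S i. ldeg (b i j))"
    by (simp add: sum.distrib sum_distrib_left)
  finally have "ldeg (g i0) + (q - 1) \<le> (q - 1) * (\<Sum>i\<in>J. \<Sum>j\<in>S i. ldeg (b i j))" by linarith
  then have "ldeg (f i0) + (q - 1) \<le>
      (q - 1) * ((\<Sum>j\<in>S i0. ldeg (b i0 j)) + (\<Sum>i\<in>J. \<Sum>j\<in>S i. ldeg (b i j)))"
    using ldeg_g[OF I(2)] by (simp add: distrib_left)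
  \<comment> \<open>Inserting \<open>i0\<close> gives cardinality \<open>q + 1\<close>, so
    \<open>q - 1\<close> becomes the cardinality minus 2.\<close>
  moreover have "i0 \<notin> J" using J by blast
  ultimately show ?thesis
    using that[of "insert i0 J"] J I(2) finJ q by (auto simp: q_def)
qed

end

(* The guard f i \<noteq> 0 is necessary: 0 is relatively prime to every element, so a row with f i = 0
   constrains none of its factors except the vanishing ones. *)
theorem theorem3p1:
  fixes scale :: "'k::{alg_closed_field, field_char_0} \<Rightarrow> 'b::idom \<Rightarrow> 'b"
    and D :: "'b \<Rightarrow> 'b"
    and m :: nat and n :: "nat \<Rightarrow> nat"
    and a :: "nat \<Rightarrow> 'b"
    and b :: "nat \<Rightarrow> nat \<Rightarrow> 'b" and k :: "nat \<Rightarrow> nat \<Rightarrow> nat"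
    and f :: "nat \<Rightarrow> 'b"
  assumes "commutative_domain_over scale"
    and "commutative_domain_over.locally_nilpotent_derivation scale D"
    and "m \<ge> 3"
    and "\<And>i. i \<in> {1..m} \<Longrightarrow> n i > 0"
    and "\<And>i. i \<in> {1..m} \<Longrightarrow> a i \<in> Ker D \<and> a i \<noteq> 0"
    and "\<And>i j. i \<in> {1..m} \<Longrightarrow> j \<in> {1..n i} \<Longrightarrow> k i j > 0"
    and "\<And>i. i \<in> {1..m} \<Longrightarrow> f i = a i * (\<Prod>j = 1..n i. b i j ^ k i j)"
    and "(\<Sum>i = 1..m. f i) = 0"
    and "\<And>i i'. i \<in> {1..m} \<Longrightarrow> i' \<in> {1..m} \<Longrightarrow> i \<noteq> i' \<Longrightarrow> relatively_prime (f i) (f i')"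
    and "(\<Sum>i = 1..m. \<Sum>j = 1..n i. 1 / real (k i j)) \<le> 1 / (real m - 2)"
  shows "\<forall>i \<in> {1..m}. f i \<noteq> 0 \<longrightarrow> (\<forall>j \<in> {1..n i}. b i j \<in> Ker D)"
proof (intro ballI impI)
  fix i j assume i: "i \<in> {1..m}" and fi: "f i \<noteq> 0" and j: "j \<in> {1..n i}"
  interpret commutative_domain_over scale by fact
  have D: "derivation D" "\<And>x. \<exists>n. (D ^^ n) x = 0"
    using assms(2) by (auto simp: locally_nilpotent_derivation_def)
  interpret lnd D
  proof
    show "D (x + y) = D x + D y" for x y
      using D(1) unfolding derivation_def Vector_Spaces.linear_def module_hom_def
        module_hom_axioms_def by blast
    show "D (x * y) = D x * y + x * D y" for x y
      using D(1) unfolding derivation_def by blast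
    show "\<exists>n. (D ^^ n) x = 0" for x by (rule D(2))
    show "of_nat l \<noteq> (0::'b)" if "0 < l" for l
    proof -
      \<comment> \<open>Characteristic zero passes from the field to the domain through multiples of
        \<open>1\<close>.\<close>
      have "of_nat l = scale (of_nat l) 1"
        by (induction l) (auto simp: scale_left_distrib)
      then show ?thesis using that by (simp add: scale_eq_0_iff)
    qed
  qed
  \<comment> \<open>Dropping zero summands keeps the sum zero and meets the nonvanishing condition
    of \<open>mason_inequality\<close>.\<close>
  define I where "I = {i \<in> {1..m}. f i \<noteq> 0}"
  have I: "finite I" "I \<subseteq> {1..m}" "i \<in> I" using i fi by (auto simp: I_def)
  define d where "d = Max ((\<lambda>i. ldeg (f i)) ` I)"
  have "d \<in> (\<lambda>i. ldeg (f i)) ` I" unfolding d_def using I by (intro Max_in) auto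
  then obtain i0 where i0: "i0 \<in> I" "ldeg (f i0) = d" by auto
  have d_max: "ldeg (f i') \<le> d" if "i' \<in> I" for i'
    unfolding d_def using I(1) that by (intro Max_ge) auto
  have "(\<Sum>i\<in>I. f i) = (\<Sum>i = 1..m. f i)"
    by (rule sum.mono_neutral_left) (auto simp: I_def)
  then have sum0: "(\<Sum>i\<in>I. f i) = 0" using assms(8) by simp
  obtain J where J: "J \<subseteq> I" "i0 \<in> J" "2 \<le> card J"
    and ineq: "ldeg (f i0) + (card J - 2) \<le>
      (card J - 2) * (\<Sum>i\<in>J. \<Sum>j = 1..n i. ldeg (b i j))"
  proof (rule mason_inequality[OF I(1) i0(1) sum0, where a = a and b = b and k = k and
        S = "\<lambda>i. {1..n i}"])
    fix i assume i: "i \<in> I"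
    then have im: "i \<in> {1..m}" using I(2) by blast
    show "f i \<noteq> 0" using i by (simp add: I_def)
    show "D (a i) = 0" using assms(5)[OF im] by (simp add: Ker_def)
    show "f i = a i * (\<Prod>j = 1..n i. b i j ^ k i j)" by (rule assms(7)[OF im])
    show "finite {1..n i}" by simp
    show "k i j > 0" if "j \<in> {1..n i}" for j by (rule assms(6)[OF im that])
    show "relatively_prime (f i0) (f i)" if "i \<noteq> i0"
      using assms(9)[OF _ im] i0(1) that I(2) by blast
  qed
  note ineq = ineq[unfolded i0(2)]
  have deg_b: "k i j * ldeg (b i j) \<le> d" if "i \<in> I" "j \<in> {1..n i}" for i j
  proof -
    have im: "i \<in> {1..m}" using that(1) I(2) by blast
    have nz: "f i \<noteq> 0" using that(1) by (simp add: I_def)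
    have b_nz: "b i j' \<noteq> 0" if "j' \<in> {1..n i}" for j'
      using nz assms(6)[OF im that] that by (auto simp: assms(7)[OF im])
    have "k i j * ldeg (b i j) \<le> (\<Sum>j = 1..n i. k i j * ldeg (b i j))"
      using that(2) by (intro member_le_sum) auto
    also have "\<dots> = ldeg (\<Prod>j = 1..n i. b i j ^ k i j)"
      using b_nz by (subst ldeg_prod) (auto simp: ldeg_power)
    also have "\<dots> \<le> ldeg (f i)"
      using nz unfolding assms(7)[OF im] by (subst ldeg_mult) auto
    finally show ?thesis using d_max[OF that(1)] by simp
  qed
  have "d = 0"
  proof -
    let ?R = "\<Sum>i\<in>J. \<Sum>j = 1..n i. ldeg (b i j)"
    have "real ?R = (\<Sum>i\<in>J. \<Sum>j = 1..n i. real (ldeg (b i j)))" by simp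
    also have "\<dots> \<le> (\<Sum>i\<in>J. \<Sum>j = 1..n i. real d * (1 / real (k i j)))"
    proof (intro sum_mono)
      fix i j assume "i \<in> J" "j \<in> {1..n i}"
      then have ij: "i \<in> I" "j \<in> {1..n i}" using J(1) by auto
      have "real (k i j) * real (ldeg (b i j)) \<le> real d"
        using deg_b[OF ij] by (metis of_nat_le_iff of_nat_mult)
      moreover have "k i j > 0" using assms(6) ij I(2) by blast
      ultimately show "real (ldeg (b i j)) \<le> real d * (1 / real (k i j))"
        by (simp add: field_simps)
    qed
    also have "\<dots> \<le> (\<Sum>i = 1..m. \<Sum>j = 1..n i. real d * (1 / real (k i j)))"
      using J(1) I(2) by (intro sum_mono2) (auto intro: sum_nonneg)
    also have "\<dots> = real d * (\<Sum>i = 1..m. \<Sum>j = 1..n i. 1 / real (k i j))"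
      by (simp add: sum_distrib_left)
    also have "\<dots> \<le> real d * (1 / (real m - 2))"
      by (rule mult_left_mono[OF assms(10)]) simp
    finally have R: "real ?R * (real m - 2) \<le> real d"
      using assms(3) by (simp add: field_simps)
    have "card J \<le> m"
      using card_mono[of "{1..m}" J] J(1) I(2) by auto
    then have "real (card J - 2) * real ?R \<le> (real m - 2) * real ?R"
      using J(3) by (intro mult_right_mono of_nat_0_le_iff) auto
    moreover have "real d + real (card J - 2) \<le> real (card J - 2) * real ?R"
      using ineq by (simp only: flip: of_nat_add of_nat_mult)
    \<comment> \<open>The chain is \<open>d + (card J - 2) \<le> (card J - 2) * ?R \<le> (m - 2) *
      ?R \<le> d\<close>. Once \<open>card J - 2\<close> is \<open>0\<close>, \<open>ineq\<close>
      reads \<open>d \<le> 0\<close>.\<close>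
    ultimately have "card J - 2 = 0" using R by (simp add: mult.commute)
    then show ?thesis using ineq by simp
  qed
  then have "ldeg (b i j) = 0"
    using deg_b[OF I(3) j] assms(6)[OF i j] by simp
  then show "b i j \<in> Ker D" by (simp add: ldeg_eq_0_iff Ker_def)
qed


end
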